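(* Algorithm EvenElect (the explicit algorithm, together with its advice, defined in the context) solves leader election in trees of size $n$ and even diameter $diam\le D$ in time $diam-2$ using $O(\log D)$ bits of advice.
   Context: Trees are finite, undirected and anonymous (nodes have no labels), and are port-numbered: at each node $v$ of degree $d$ the incident edges carry distinct port numbers from $\{0,\dots,d-1\}$; there is no relation between the two port numbers of an edge at its two endpoints. The size of a tree is its number of nodes. Leader election in $T$: every node $v$ must output a sequence $P(v)=(p_1,\dots,p_k)$ of nonnegative integers. Let $P^*(v)$ be the path starting at $v$ obtained by taking $p_i$ as the outgoing port at the $i$-th node of the path. All $P^*(v)$ must be simple paths in $T$ ending at one common node (the leader). Model (LOCAL, deterministic, with advice): communication proceeds in synchronous rounds, all nodes start simultaneously, and in each round each node can exchange arbitrary messages with all its neighbours and perform arbitrary local computations. The view $V(v,r)$, which is all the information that $v$ gets about $T$ in $r$ rounds, consists of the subtree of $T$ induced by all nodes at distance at most $r$ from $v$, with all port numbers at these nodes and with the degrees of all nodes at distance exactly $r$ from $v$. An oracle knowing the entire tree provides one binary string $A$ to all nodes at the start; its length is the size of advice. The time is the number of rounds used. Notation: "path" means simple path; $d(a,b)$ is the distance; $path(a,b)$ is the path from $a$ to $b$; $seq(a,b)$ is the sequence of all ports encountered when moving from $a$ to $b$ on $path(a,b)$, and its odd-indexed terms are its outgoing ports. An endless path in $V(v,r)$ is a simple path of length $r$ with endpoints $v$ and $v'$ such that $v'$ is not a leaf of $T$. When the diameter $diam$ is even, the central node of the tree is the unique node in the middle of every simple path of length $diam$. Advice for EvenElect: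 the value of $diam$. Algorithm EvenElect($A$), executed at each node $v$ of $T$: 1. Read $diam$ from $A$ and set $h=diam/2$. Use $diam-2$ rounds of communication to learn $V(v,diam-2)$. 2. If $V(v,diam-2)$ contains no endless paths starting at $v$, let $v_c$ be the central node of $V(v,diam-2)$. 3. Else: let $g_v$ be the node $w$ in $V(v,diam-2)$ furthest from $v$ such that every endless path in $V(v,diam-2)$ passes through $w$. If $d(v,g_v)\le h-1$, or $V(v,diam-2)$ contains a node $w$ such that $d(w,g_v)>d(v,g_v)$, set $\ell=h-1$; otherwise set $\ell=h$. Let $v_c$ be the node on $path(v,g_v)$ at distance $\ell$ from $v$. 4. Output the sequence of outgoing ports of $seq(v,v_c)$.
   Formalization: Trees of diameter 2 are excluded: there the algorithm uses 0 rounds, each leaf sees only itself, has no endless path and elects itself, so the claim fails for every such tree; for diameter 0 the time diam-2 is read as 0. *)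

theory Defs
  imports "HOL-Library.Landau_Symbols" "HOL-Library.Log_Nat"
begin

section \<open>Port-numbered graphs and trees\<close>

text \<open>
  \<open>port G v w\<close> is the port number at \<open>v\<close> of the edge joining \<open>v\<close> and \<open>w\<close>; it is
  meaningful only if \<open>adj G v w\<close>.
\<close>

record 'v pgraph =
  nodes :: "'v set"
  adj :: "'v \<Rightarrow> 'v \<Rightarrow> bool"
  port :: "'v \<Rightarrow> 'v \<Rightarrow> nat"

definition nbrs :: "('v, 'z) pgraph_scheme \<Rightarrow> 'v \<Rightarrow> 'v set" where
  "nbrs G v = {w \<in> nodes G. adj G v w}"

definition degree :: "('v, 'z) pgraph_scheme \<Rightarrow> 'v \<Rightarrow> nat" where
  "degree G v = card (nbrs G v)"

definition walk :: "('v, 'z) pgraph_scheme \<Rightarrow> 'v list \<Rightarrow> bool" where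
  "walk G p \<longleftrightarrow> p \<noteq> [] \<and> set p \<subseteq> nodes G \<and> (\<forall>i. Suc i < length p \<longrightarrow> adj G (p ! i) (p ! Suc i))"

definition is_path :: "('v, 'z) pgraph_scheme \<Rightarrow> 'v \<Rightarrow> 'v list \<Rightarrow> 'v \<Rightarrow> bool" where
  "is_path G a p b \<longleftrightarrow> walk G p \<and> distinct p \<and> hd p = a \<and> last p = b"

definition is_cycle :: "('v, 'z) pgraph_scheme \<Rightarrow> 'v list \<Rightarrow> bool" where
  "is_cycle G p \<longleftrightarrow> walk G p \<and> distinct p \<and> 3 \<le> length p \<and> adj G (last p) (hd p)"

definition port_tree :: "('v, 'z) pgraph_scheme \<Rightarrow> bool" where
  "port_tree G \<longleftrightarrow>
     finite (nodes G) \<and> nodes G \<noteq> {} \<and>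
     (\<forall>v w. adj G v w \<longrightarrow> v \<in> nodes G \<and> w \<in> nodes G \<and> v \<noteq> w \<and> adj G w v) \<and>
     (\<forall>a\<in>nodes G. \<forall>b\<in>nodes G. \<exists>p. is_path G a p b) \<and>
     (\<nexists>p. is_cycle G p) \<and>
     (\<forall>v\<in>nodes G. inj_on (port G v) (nbrs G v) \<and> port G v ` nbrs G v \<subseteq> {0..<degree G v})"

text \<open>The length of a path counts its edges.\<close>

definition tdist :: "('v, 'z) pgraph_scheme \<Rightarrow> 'v \<Rightarrow> 'v \<Rightarrow> nat" where
  "tdist G a b = (LEAST k. \<exists>p. is_path G a p b \<and> length p = Suc k)"

definition path_between :: "('v, 'z) pgraph_scheme \<Rightarrow> 'v \<Rightarrow> 'v \<Rightarrow> 'v list" where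
  "path_between G a b = (THE p. is_path G a p b)"

definition diam :: "('v, 'z) pgraph_scheme \<Rightarrow> nat" where
  "diam G = Max {tdist G a b | a b. a \<in> nodes G \<and> b \<in> nodes G}"

definition central_node :: "('v, 'z) pgraph_scheme \<Rightarrow> 'v" where
  "central_node G = (THE c. c \<in> nodes G \<and>
     (\<forall>a b p. is_path G a p b \<and> length p = Suc (diam G) \<longrightarrow> p ! (diam G div 2) = c))"

fun ports_along :: "('v, 'z) pgraph_scheme \<Rightarrow> 'v list \<Rightarrow> nat list" where
  "ports_along G (x # y # zs) = port G x y # port G y x # ports_along G (y # zs)"
| "ports_along G _ = []"

definition seq :: "('v, 'z) pgraph_scheme \<Rightarrow> 'v \<Rightarrow> 'v \<Rightarrow> nat list" where
  "seq G a b = ports_along G (path_between G a b)"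

text \<open>Counting the terms of a sequence from 1, so that \<open>odd_terms (seq G a b)\<close> are the
  outgoing ports.\<close>

fun odd_terms :: "'a list \<Rightarrow> 'a list" where
  "odd_terms (x # y # zs) = x # odd_terms zs"
| "odd_terms xs = xs"


section \<open>Leader election\<close>

text \<open>\<open>q\<close> is the node sequence traversed from \<open>v\<close> by taking the outgoing ports \<open>ps\<close>; there
  is none if some term of \<open>ps\<close> is not a port number of the node where it has to be taken.\<close>

definition follows :: "('v, 'z) pgraph_scheme \<Rightarrow> 'v \<Rightarrow> nat list \<Rightarrow> 'v list \<Rightarrow> bool" where
  "follows G v ps q \<longleftrightarrow> walk G q \<and> hd q = v \<and> length q = Suc (length ps) \<and>
     (\<forall>i < length ps. port G (q ! i) (q ! Suc i) = ps ! i)"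

definition elects_leader :: "('v, 'z) pgraph_scheme \<Rightarrow> ('v \<Rightarrow> nat list) \<Rightarrow> bool" where
  "elects_leader G P \<longleftrightarrow> (\<exists>leader\<in>nodes G. \<forall>v\<in>nodes G. \<exists>q.
     follows G v (P v) q \<and> is_path G v q leader)"


section \<open>Views and the LOCAL model with advice\<close>

text \<open>\<open>origin\<close> is the node whose view this is, \<open>vdeg\<close> gives the degrees in the underlying tree.\<close>

record 'v local_view = "'v pgraph" +
  origin :: 'v
  vdeg :: "'v \<Rightarrow> nat"

text \<open>
  Nodes have no labels, so the view \<open>V(v,r)\<close> must not reveal their identities in \<open>T\<close>. We
  therefore rename every node \<open>w\<close> of the view to the port sequence \<open>seq T v w\<close>, which
  distinguishes the nodes of \<open>T\<close>; the origin becomes the empty sequence. Fields are given fixed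
  values outside the view, so that nodes with the same port-numbered view, possibly in
  different trees, get equal records. The degrees of nodes at distance less than \<open>r\<close> are already
  determined by the induced subtree; recording them adds no information.
\<close>

definition view :: "('v, 'z) pgraph_scheme \<Rightarrow> 'v \<Rightarrow> nat \<Rightarrow> nat list local_view" where
  "view T v r =
     (let B = {w \<in> nodes T. tdist T v w \<le> r};
          N = seq T v ` B;
          u = inv_into B (seq T v);
          E = (\<lambda>s t. s \<in> N \<and> t \<in> N \<and> adj T (u s) (u t))
      in \<lparr>nodes = N,
          adj = E,
          port = (\<lambda>s t. if E s t then port T (u s) (u t) else 0),
          origin = seq T v v,
          vdeg = (\<lambda>s. if s \<in> N then degree T (u s) else 0)\<rparr>)"

text \<open>
  What a node knows after \<open>r\<close> rounds is the advice and its view to distance \<open>r\<close>. A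
  deterministic algorithm thus consists of a number of rounds, here depending on the advice, and
  of an output as a function of the advice and of the resulting view.
\<close>

record local_algorithm =
  rounds :: "bool list \<Rightarrow> nat"
  decide :: "bool list \<Rightarrow> nat list local_view \<Rightarrow> nat list"

definition solves_leader_election ::
    "local_algorithm \<Rightarrow> ('v, 'z) pgraph_scheme \<Rightarrow> bool list \<Rightarrow> nat \<Rightarrow> bool" where
  "solves_leader_election alg T A t \<longleftrightarrow>
     rounds alg A = t \<and>
     elects_leader T (\<lambda>v. decide alg A (view T v (rounds alg A)))"


section \<open>Algorithm EvenElect\<close>

text \<open>Advice: the standard binary representation, least significant bit first.\<close>

definition encode_nat :: "nat \<Rightarrow> bool list" where
  "encode_nat n = map (bit n) [0..<nat (bitlen (int n))]"

definition decode_nat :: "bool list \<Rightarrow> nat" where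
  "decode_nat bs = horner_sum of_bool 2 bs"

definition even_elect_advice :: "('v, 'z) pgraph_scheme \<Rightarrow> bool list" where
  "even_elect_advice T = encode_nat (diam T)"

text \<open>An endless path of \<open>V(v,r)\<close> starting at \<open>v\<close>. Its other endpoint is a leaf of the tree
  iff it has degree 1 there.\<close>

definition endless_path :: "('v, 'z) local_view_scheme \<Rightarrow> nat \<Rightarrow> 'v list \<Rightarrow> bool" where
  "endless_path V r p \<longleftrightarrow>
     is_path V (origin V) p (last p) \<and> length p = Suc r \<and> vdeg V (last p) \<noteq> 1"

definition g_node :: "('v, 'z) local_view_scheme \<Rightarrow> nat \<Rightarrow> 'v" where
  "g_node V r = (ARG_MAX (tdist V (origin V)) w.
     w \<in> nodes V \<and> (\<forall>p. endless_path V r p \<longrightarrow> w \<in> set p))"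

text \<open>\<open>d\<close> is the diameter read from the advice. The test \<open>tdist V v g + 1 \<le> h\<close> is
  \<open>d(v,g\<^sub>v) \<le> h - 1\<close> without truncated subtraction.\<close>

definition even_elect_center :: "nat \<Rightarrow> ('v, 'z) local_view_scheme \<Rightarrow> 'v" where
  "even_elect_center d V =
     (let h = d div 2; r = d - 2; v = origin V
      in if \<nexists>p. endless_path V r p then central_node V
         else
           let g = g_node V r;
               l = (if tdist V v g + 1 \<le> h \<or> (\<exists>w\<in>nodes V. tdist V w g > tdist V v g)
                    then h - 1 else h)
           in THE c. c \<in> set (path_between V v g) \<and> tdist V v c = l)"

text \<open>
  If the diameter is 2, no rounds are used, and a leaf sees only itself and has no endless
  path, so it elects itself: the algorithm does not elect a common leader in this case. If the
  tree is a single node, \<open>diam - 2\<close> is read as 0 rounds.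
\<close>

definition EvenElect :: local_algorithm where
  "EvenElect =
     \<lparr>rounds = (\<lambda>A. decode_nat A - 2),
      decide = (\<lambda>A V. odd_terms (seq V (origin V) (even_elect_center (decode_nat A) V)))\<rparr>"

end

theory Submission
  imports Defs
begin

text \<open>
  Let \<open>diam = 2h\<close> and let \<open>c\<close> be the middle of a diametral path; every node has distance at most
  \<open>h\<close> from \<open>c\<close>. If a node \<open>v\<close> has no endless path in its view, it sees the whole tree.
  Otherwise an endless path extends to length \<open>2h - 1\<close>, so it crosses \<open>c\<close> and \<open>v\<close> has distance
  \<open>h - 1\<close> or \<open>h\<close> from \<open>c\<close>. Hence \<open>c\<close> lies on the path from \<open>v\<close> to \<open>g\<^sub>v\<close>, and comparing the distances
  to \<open>g\<^sub>v\<close> in the view decides between the two values. All nodes thus elect \<open>c\<close>. A view is a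
  convex part of the tree with the nodes renamed injectively, so that paths, distances and ports
  in it agree with those of the tree.
\<close>

section \<open>Paths in trees\<close>

lemma walk_successively:
  "walk G p \<longleftrightarrow> p \<noteq> [] \<and> set p \<subseteq> nodes G \<and> successively (adj G) p"
  by (auto simp: walk_def successively_conv_nth)

text \<open>Cutting out the stretch between two occurrences of a node shortens the walk strictly. So
  if no length is lost, nothing was cut and the walk was already simple.\<close>

lemma walk_imp_path:
  assumes "walk G w"
  shows "\<exists>p. is_path G (hd w) p (last w) \<and> set p \<subseteq> set w \<and> length p \<le> length w \<and>
    (length p = length w \<longrightarrow> distinct w)"
  using assms
proof (induction "length w" arbitrary: w rule: less_induct)
  case less
  show ?case
  proof (cases "distinct w")
    case True
    then show ?thesis using less.prems by (auto simp: is_path_def)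
  next
    case False
    then obtain xs ys zs y where w: "w = xs @ [y] @ ys @ [y] @ zs"
      using not_distinct_decomp by blast
    let ?w = "xs @ [y] @ zs"
    have "walk G ?w"
      using less.prems unfolding walk_successively w
      by (auto simp: successively_append_iff successively_Cons)
    from less.hyps[OF _ this] obtain p where
      "is_path G (hd ?w) p (last ?w)" "set p \<subseteq> set ?w" "length p \<le> length ?w"
      by (auto simp: w)
    then show ?thesis by (intro exI[of _ p]) (auto simp: w hd_append)
  qed
qed

text \<open>\<open>arg_max\<close> is a choice; a maximizer must exist before anything can be said
  about \<open>g_node\<close>.\<close>

lemma arg_max_finite:
  fixes f :: "'a \<Rightarrow> 'b::linorder"
  assumes "finite (Collect Q)" "Collect Q \<noteq> {}"
  shows "is_arg_max f Q (arg_max f Q)"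
proof -
  have "Max (f ` Collect Q) \<in> f ` Collect Q"
    using assms by (intro Max_in) auto
  then obtain m where m: "Q m" "f m = Max (f ` Collect Q)" by auto
  have "f x \<le> f m" if "Q x" for x
    unfolding m(2) using assms(1) that by (intro Max_ge) auto
  then have "is_arg_max f Q m" using m(1) by (simp add: is_arg_max_linorder)
  then show ?thesis unfolding arg_max_def by (rule someI)
qed

locale ptree =
  fixes T :: "('v, 'z) pgraph_scheme"
  assumes tree: "port_tree T"
begin

abbreviation "N \<equiv> nodes T"
abbreviation "d \<equiv> tdist T"
abbreviation "P \<equiv> path_between T"

lemma finite_N: "finite N" and N_nonempty: "N \<noteq> {}"
  using tree by (auto simp: port_tree_def)

lemma adj_sym: "adj T x y \<Longrightarrow> adj T y x"
  and adj_nodes: "adj T x y \<Longrightarrow> x \<in> N \<and> y \<in> N \<and> x \<noteq> y"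
  using tree by (auto simp: port_tree_def)

lemma no_cycle: "\<not> is_cycle T p"
  using tree by (auto simp: port_tree_def)

lemma port_inj: "adj T v x \<Longrightarrow> adj T v y \<Longrightarrow> port T v x = port T v y \<Longrightarrow> x = y"
  using tree adj_nodes[of v x] adj_nodes[of v y]
  unfolding port_tree_def nbrs_def inj_on_def by blast

lemma successively_adj_rev: "successively (adj T) (rev p) = successively (adj T) p"
proof -
  have "(\<lambda>x y. adj T y x) = adj T"
    using adj_sym by blast
  then show ?thesis by (metis successively_rev)
qed

text \<open>If the first steps differ, the stretches up to the first meeting close to a cycle; if
  they agree, induction applies to the tails.\<close>

lemma path_unique:
  "is_path T a p b \<Longrightarrow> is_path T a q b \<Longrightarrow> p = q"
proof (induction p arbitrary: a q)
  case Nil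
  then show ?case by (simp add: is_path_def walk_def)
next
  case (Cons a' p)
  have a': "a' = a" using Cons.prems by (simp add: is_path_def)
  obtain q' where q: "q = a # q'"
    using Cons.prems by (cases q) (auto simp: is_path_def walk_def)
  show ?case
  proof (cases "p = [] \<or> q' = []")
    case True
    then show ?thesis
      using Cons.prems unfolding q a' is_path_def
      by (metis distinct.simps(2) last_ConsL last_ConsR last_in_set)
  next
    case False
    then have ne: "p \<noteq> []" "q' \<noteq> []" by auto
    have wp: "set p \<subseteq> N" "successively (adj T) p" "adj T a (hd p)" "a \<in> N"
      and wq: "set q' \<subseteq> N" "successively (adj T) q'" "adj T a (hd q')"
      and dp: "distinct p" "a \<notin> set p" "last p = b"
      and dq: "distinct q'" "a \<notin> set q'" "last q' = b"
      using Cons.prems ne unfolding q a' is_path_def walk_successively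
      by (auto simp: successively_Cons)
    have hd: "hd p = hd q'"
    proof (rule ccontr)
      assume diff: "hd p \<noteq> hd q'"
      have "\<exists>y\<in>set q'. y \<in> set p"
        using ne dp(3) dq(3) last_in_set by metis
      then obtain q1 y q2 where q': "q' = q1 @ y # q2" and y: "y \<in> set p"
        and q1: "\<forall>z\<in>set q1. z \<notin> set p"
        using split_list_first_prop[of q' "\<lambda>z. z \<in> set p"] by blast
      obtain p1 p2 where p: "p = p1 @ y # p2"
        using y by (meson split_list)
      \<comment> \<open>Along \<open>p\<close> to \<open>y\<close>, then back along
        \<open>q'\<close>. As \<open>y\<close> is the first node of \<open>q'\<close> on
        \<open>p\<close>, the way back avoids \<open>p\<close>.\<close>
      let ?c = "a # p1 @ y # rev q1"
      have "distinct ?c"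
        using dp dq q1 unfolding p q' by auto
      moreover have "walk T ?c"
      proof -
        have "successively (adj T) (rev (q1 @ [y]))"
          using wq(2) unfolding successively_adj_rev q'
          by (auto simp: successively_append_iff successively_Cons)
        then show ?thesis
          using wp wq(1) unfolding p q' walk_successively
          by (cases p1)
            (auto simp: successively_append_iff successively_Cons hd_append split: if_splits)
      qed
      \<comment> \<open>Different first steps mean that \<open>p1\<close> and \<open>q1\<close> are
        not both empty.\<close>
      moreover have "3 \<le> length ?c"
        using diff unfolding p q' by (cases p1; cases q1) auto
      moreover have "adj T (last ?c) (hd ?c)"
        using wq(3) adj_sym unfolding q' by (cases q1) auto
      ultimately have "is_cycle T ?c" by (simp add: is_cycle_def)
      then show False using no_cycle by blast
    qed
    have "is_path T (hd p) p b" "is_path T (hd p) q' b"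
      using ne wp wq dp dq hd by (auto simp: is_path_def walk_successively)
    from Cons.IH[OF this] show ?thesis by (simp add: q a')
  qed
qed

lemma path_between_eqI: "is_path T a p b \<Longrightarrow> P a b = p"
  unfolding path_between_def using path_unique by blast

lemma path_nodes: "is_path T a p b \<Longrightarrow> a \<in> N \<and> b \<in> N \<and> set p \<subseteq> N \<and> a \<in> set p \<and> b \<in> set p"
  by (auto simp: is_path_def walk_def)

lemma is_path_P: "a \<in> N \<Longrightarrow> b \<in> N \<Longrightarrow> is_path T a (P a b) b"
  using tree path_between_eqI unfolding port_tree_def by metis

lemma set_P: "a \<in> N \<Longrightarrow> b \<in> N \<Longrightarrow> set (P a b) \<subseteq> N \<and> a \<in> set (P a b) \<and> b \<in> set (P a b)"
  using is_path_P path_nodes by blast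

section \<open>Distances, betweenness and medians\<close>

lemma path_length: "is_path T a p b \<Longrightarrow> length p = Suc (d a b)"
proof -
  assume p: "is_path T a p b"
  then have "p \<noteq> []" by (auto simp: is_path_def walk_def)
  \<comment> \<open>By uniqueness only one length occurs, so \<open>LEAST\<close> has a single
    candidate.\<close>
  then have "(\<lambda>k. \<exists>q. is_path T a q b \<and> length q = Suc k) = (\<lambda>k. length p = Suc k)"
    using p path_unique by (intro ext) metis
  then have "d a b = (LEAST k. length p = Suc k)"
    unfolding tdist_def by simp
  also have "\<dots> = length p - 1"
    using \<open>p \<noteq> []\<close> by (intro Least_equality) (cases p; auto)+
  finally show ?thesis using \<open>p \<noteq> []\<close> by (cases p) auto
qed

lemma length_P: "a \<in> N \<Longrightarrow> b \<in> N \<Longrightarrow> length (P a b) = Suc (d a b)"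
  using is_path_P path_length by blast

lemma P_rev: "a \<in> N \<Longrightarrow> b \<in> N \<Longrightarrow> P b a = rev (P a b)"
  using is_path_P[of a b]
  by (intro path_between_eqI)
    (auto simp: is_path_def walk_successively successively_adj_rev hd_rev last_rev
      simp del: successively_rev)

lemma d_sym: "a \<in> N \<Longrightarrow> b \<in> N \<Longrightarrow> d a b = d b a"
  using length_P[of a b] length_P[of b a] P_rev[of a b] by simp

lemma d_self: "a \<in> N \<Longrightarrow> d a a = 0"
  using path_length[of a "[a]" a] by (simp add: is_path_def walk_def)

lemma d_eq_0: "a \<in> N \<Longrightarrow> b \<in> N \<Longrightarrow> d a b = 0 \<longleftrightarrow> a = b"
proof -
  assume ab: "a \<in> N" "b \<in> N"
  have "a = b" if "d a b = 0"
    using that is_path_P[OF ab] length_P[OF ab]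
    by (cases "P a b") (auto simp: is_path_def)
  then show ?thesis using d_self ab by auto
qed

text \<open>Every walk contains the path between its ends, so a walk of minimal length is that
  path.\<close>

lemma d_walk:
  assumes "walk T w"
  shows "Suc (d (hd w) (last w)) \<le> length w"
    and "set (P (hd w) (last w)) \<subseteq> set w"
    and "length w = Suc (d (hd w) (last w)) \<Longrightarrow> P (hd w) (last w) = w"
proof -
  obtain p where p: "is_path T (hd w) p (last w)" "set p \<subseteq> set w" "length p \<le> length w"
    "length p = length w \<longrightarrow> distinct w"
    using walk_imp_path[OF assms] by blast
  show "Suc (d (hd w) (last w)) \<le> length w" "set (P (hd w) (last w)) \<subseteq> set w"
    using p path_length[OF p(1)] path_between_eqI[OF p(1)] by auto
  show "P (hd w) (last w) = w" if "length w = Suc (d (hd w) (last w))"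
    using that p path_length[OF p(1)] assms
    by (intro path_between_eqI) (simp add: is_path_def)
qed

text \<open>Turns metric statements into applications of \<open>d_walk\<close>; \<open>tl\<close>
  drops the second copy of \<open>b\<close>.\<close>

lemma walk_join:
  assumes "a \<in> N" "b \<in> N" "c \<in> N"
  defines "w \<equiv> P a b @ tl (P b c)"
  shows "walk T w" "hd w = a" "last w = c" "length w = Suc (d a b + d b c)"
    "set w = set (P a b) \<union> set (P b c)"
proof -
  note ab = is_path_P[OF assms(1,2)] and bc = is_path_P[OF assms(2,3)]
  obtain r where r: "P b c = b # r"
    using bc by (cases "P b c") (auto simp: is_path_def walk_def)
  obtain s where s: "P a b = s @ [b]"
    using ab by (cases "P a b" rule: rev_cases) (auto simp: is_path_def walk_def)
  have w: "w = s @ b # r" by (simp add: w_def r s)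
  show "walk T w"
    using ab bc unfolding w r s is_path_def walk_successively
    by (auto simp: successively_append_iff successively_Cons)
  show "hd w = a" using ab unfolding w s is_path_def by (cases s) auto
  show "last w = c" using bc unfolding w r is_path_def by simp
  show "length w = Suc (d a b + d b c)"
    using length_P[OF assms(1,2)] length_P[OF assms(2,3)] by (simp add: w_def)
  show "set w = set (P a b) \<union> set (P b c)" unfolding w r s by auto
qed

lemma triangle: "a \<in> N \<Longrightarrow> b \<in> N \<Longrightarrow> c \<in> N \<Longrightarrow> d a c \<le> d a b + d b c"
  using d_walk(1) walk_join[of a b c] by fastforce

lemma P_subset: "a \<in> N \<Longrightarrow> b \<in> N \<Longrightarrow> c \<in> N \<Longrightarrow> set (P a c) \<subseteq> set (P a b) \<union> set (P b c)"
  using d_walk(2) walk_join[of a b c] by fastforce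

lemma path_split:
  assumes "is_path T a (xs @ y # ys) b"
  shows "P a y = xs @ [y]" "P y b = y # ys"
proof -
  show "P a y = xs @ [y]"
    using assms by (intro path_between_eqI)
      (auto simp: is_path_def walk_successively successively_append_iff hd_append)
  show "P y b = y # ys"
    using assms by (intro path_between_eqI)
      (auto simp: is_path_def walk_successively successively_append_iff hd_append)
qed

lemma between:
  assumes "a \<in> N" "b \<in> N" "c \<in> N"
  shows "b \<in> set (P a c) \<longleftrightarrow> d a c = d a b + d b c"
proof
  assume "b \<in> set (P a c)"
  then obtain xs ys where p: "P a c = xs @ b # ys" by (meson split_list)
  note s = path_split[OF is_path_P[OF assms(1,3), unfolded p]]
  show "d a c = d a b + d b c"
    using length_P[OF assms(1,2)] length_P[OF assms(2,3)] length_P[OF assms(1,3)]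
    by (simp add: p s)
next
  assume "d a c = d a b + d b c"
  then have "P a c = P a b @ tl (P b c)"
    using d_walk(3) walk_join[OF assms] by metis
  then show "b \<in> set (P a c)" using set_P[OF assms(1,2)] by auto
qed

lemma nth_P:
  assumes "a \<in> N" "b \<in> N" "i \<le> d a b"
  shows "P a b ! i \<in> set (P a b)" "d a (P a b ! i) = i" "d (P a b ! i) b = d a b - i"
proof -
  let ?p = "P a b"
  have i: "i < length ?p" using assms length_P by simp
  then show m: "?p ! i \<in> set ?p" by simp
  have "is_path T a (take i ?p @ ?p ! i # drop (Suc i) ?p) b"
    using is_path_P[OF assms(1,2)] i by (simp add: id_take_nth_drop[symmetric])
  from path_split(1)[OF this] have "length (P a (?p ! i)) = Suc i" using i by simp
  moreover have n: "?p ! i \<in> N" using m set_P assms by blast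
  ultimately show "d a (?p ! i) = i" using length_P assms by auto
  then show "d (?p ! i) b = d a b - i" using between[OF assms(1) n assms(2)] m by simp
qed

lemma P_nth_d:
  assumes "a \<in> N" "b \<in> N" "x \<in> set (P a b)"
  shows "P a b ! d a x = x"
proof -
  obtain i where i: "i < length (P a b)" "x = P a b ! i"
    using assms(3) by (metis in_set_conv_nth)
  then show ?thesis using nth_P(2)[of a b i] assms length_P by simp
qed

text \<open>The path from \<open>a\<close> to \<open>b\<close> splits at \<open>y\<close>; if
  \<open>x\<close> falls into the second half, the distances from \<open>a\<close> force
  \<open>x = y\<close>.\<close>

lemma between_trans:
  assumes "a \<in> N" "b \<in> N" "x \<in> set (P a b)" "y \<in> set (P a b)" "d a x \<le> d a y"
  shows "x \<in> set (P a y)"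
proof -
  have n: "x \<in> N" "y \<in> N" using assms set_P by blast+
  have "x \<in> set (P a y) \<or> x \<in> set (P y b)"
    using P_subset[OF assms(1) n(2) assms(2)] assms(3) by blast
  moreover have "x \<in> set (P a y)" if x: "x \<in> set (P y b)"
  proof -
    have "d y b = d y x + d x b" "d a b = d a x + d x b" "d a b = d a y + d y b"
      using between x assms n by auto
    then have "d y x = 0" using assms(5) by simp
    then show ?thesis using d_eq_0 n set_P assms(1) by blast
  qed
  ultimately show ?thesis by blast
qed

lemma P_prefix_subset:
  assumes "a \<in> N" "b \<in> N" "y \<in> set (P a b)"
  shows "set (P a y) \<subseteq> set (P a b)"
proof -
  obtain xs ys where p: "P a b = xs @ y # ys" using assms(3) by (meson split_list)
  show ?thesis using path_split[OF is_path_P[OF assms(1,2), unfolded p]] p by auto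
qed

text \<open>A node of \<open>P x y\<close> closest to \<open>c\<close> is the median of \<open>c\<close>, \<open>x\<close>, \<open>y\<close>.\<close>

lemma median:
  assumes "x \<in> N" "y \<in> N" "c \<in> N"
  obtains m where "m \<in> set (P x y)" "d c x = d c m + d m x" "d c y = d c m + d m y"
proof -
  define m where "m = arg_min_on (d c) (set (P x y))"
  have ne: "set (P x y) \<noteq> {}" using set_P[OF assms(1,2)] by auto
  have m: "m \<in> set (P x y)" unfolding m_def using ne by (intro arg_min_if_finite) auto
  have min: "d c m \<le> d c z" if "z \<in> set (P x y)" for z
    unfolding m_def using that ne by (intro arg_min_least) auto
  have mN: "m \<in> N" using m set_P assms by blast
  have *: "d c z = d c m + d m z" if z: "z \<in> N" and sub: "set (P m z) \<subseteq> set (P x y)" for z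
  proof -
    \<comment> \<open>A second common node would lie on \<open>P x y\<close> and be strictly closer
      to \<open>c\<close> than \<open>m\<close>.\<close>
    have "distinct (P c m @ tl (P m z))"
    proof -
      have dis: "distinct (P c m)" "distinct (P m z)" "hd (P m z) = m" "P m z \<noteq> []"
        using is_path_P[OF assms(3) mN] is_path_P[OF mN z] by (auto simp: is_path_def walk_def)
      have "t \<notin> set (P c m)" if t: "t \<in> set (tl (P m z))" for t
      proof
        assume tc: "t \<in> set (P c m)"
        have "t \<in> set (P m z)" using t dis(4) by (meson list.set_sel(2))
        then have "d c m \<le> d c t" using min sub by blast
        moreover have tN: "t \<in> N" using tc set_P assms(3) mN by blast
        moreover have "d c m = d c t + d t m" using between tc assms(3) mN tN by auto
        ultimately have "t = m" using d_eq_0[OF tN mN] by simp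
        then show False using t dis by (cases "P m z") auto
      qed
      then show ?thesis using dis by (auto simp: distinct_tl)
    qed
    then have "is_path T c (P c m @ tl (P m z)) z"
      using walk_join[OF assms(3) mN z] by (simp add: is_path_def)
    from path_length[OF this] show ?thesis using walk_join(4)[OF assms(3) mN z] by simp
  qed
  have "set (P m x) \<subseteq> set (P x y)"
    using P_prefix_subset[OF assms(1,2) m] P_rev[OF mN assms(1)] by simp
  moreover have "set (P m y) \<subseteq> set (P x y)"
    using P_prefix_subset[OF assms(2,1), of m] m P_rev[OF mN assms(2)] P_rev[OF assms(1,2)] by simp
  ultimately show ?thesis using that m * assms by blast
qed

text \<open>The detour from the median to \<open>c\<close> is traversed twice. The gain of 2 rather
  than 1 is what \<open>center_on_endless\<close> relies on.\<close>

lemma d_not_between: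
  assumes "x \<in> N" "y \<in> N" "c \<in> N" "c \<notin> set (P x y)"
  shows "d x y + 2 \<le> d x c + d c y"
proof -
  obtain m where m: "m \<in> set (P x y)" "d c x = d c m + d m x" "d c y = d c m + d m y"
    using median assms by blast
  have mN: "m \<in> N" using m set_P assms by blast
  have "d c m \<noteq> 0" using m(1) assms d_eq_0 mN by metis
  moreover have "d x y = d x m + d m y" using between m(1) assms mN by auto
  ultimately show ?thesis using m d_sym assms mN by simp
qed

section \<open>Leaves and extension of paths\<close>

lemma degree_inner:
  assumes "a \<in> N" "b \<in> N" "0 < i" "i < d a b"
  shows "degree T (P a b ! i) \<noteq> 1"
proof
  let ?p = "P a b"
  have len: "length ?p = Suc (d a b)" using assms length_P by blast
  have w: "walk T ?p" "distinct ?p" using is_path_P[OF assms(1,2)] by (auto simp: is_path_def)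
  assume "degree T (?p ! i) = 1"
  then obtain z where z: "nbrs T (?p ! i) = {z}"
    unfolding degree_def by (rule card_1_singletonE)
  have "adj T (?p ! (i - 1)) (?p ! Suc (i - 1))" "adj T (?p ! i) (?p ! Suc i)"
    using w(1) len assms unfolding walk_def by (auto simp del: Suc_pred)
  moreover have "Suc (i - 1) = i" using assms(3) by simp
  ultimately have "?p ! (i - 1) \<in> nbrs T (?p ! i)" "?p ! Suc i \<in> nbrs T (?p ! i)"
    using adj_sym adj_nodes by (auto simp: nbrs_def)
  then have "?p ! (i - 1) = ?p ! Suc i" using z by simp
  then show False using w(2) len assms by (simp add: nth_eq_iff_index_eq)
qed

text \<open>\<open>b\<close> has its predecessor on the path as a neighbour, and since its degree is
  not 1 it has another one to continue with.\<close>

lemma extend_path: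
  assumes "a \<in> N" "b \<in> N" "0 < d a b" "degree T b \<noteq> 1"
  obtains b' where "b' \<in> N" "d a b' = Suc (d a b)" "b \<in> set (P a b')"
proof -
  let ?p = "P a b" and ?x = "P a b ! (d a b - 1)"
  have len: "length ?p = Suc (d a b)" using assms length_P by blast
  have p: "walk T ?p" "distinct ?p" "hd ?p = a" "last ?p = b" "?p \<noteq> []"
    using is_path_P[OF assms(1,2)] by (auto simp: is_path_def walk_def)
  have "?p ! d a b = b" using p(4,5) len by (simp add: last_conv_nth)
  then have adjx: "adj T b ?x"
    using p(1) len assms(3) adj_sym unfolding walk_def
    by (metis Suc_pred' lessI)
  have "nbrs T b \<noteq> {?x}" using assms(4) by (auto simp: degree_def)
  moreover have "?x \<in> nbrs T b" using adjx adj_nodes by (simp add: nbrs_def)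
  ultimately obtain b' where b': "b' \<in> nbrs T b" "b' \<noteq> ?x" by blast
  then have adj': "adj T b b'" and b'N: "b' \<in> N" by (auto simp: nbrs_def)
  have "b' \<notin> set ?p"
  proof
    assume m: "b' \<in> set ?p"
    have "is_path T b' [b', b] b"
      using adj_sym[OF adj'] adj_nodes[OF adj'] by (auto simp: is_path_def walk_successively)
    then have "d b' b = 1" using path_length by force
    moreover have "d a b = d a b' + d b' b" using m between assms b'N by blast
    \<comment> \<open>The path has only one node at this distance from \<open>a\<close>, namely
      \<open>?x\<close>, which \<open>b'\<close> was chosen to avoid.\<close>
    ultimately have "d a b' = d a b - 1" by simp
    then show False using P_nth_d[OF assms(1,2) m] b'(2) by simp
  qed
  then have path: "is_path T a (?p @ [b']) b'"
    using p b'N adj' by (auto simp: is_path_def walk_successively successively_append_iff hd_append)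
  show ?thesis
    using that[OF b'N] path_length[OF path] path_between_eqI[OF path] len set_P[OF assms(1,2)]
    by auto
qed

section \<open>Diameter and center\<close>

lemma d_le_diam: "a \<in> N \<Longrightarrow> b \<in> N \<Longrightarrow> d a b \<le> diam T"
  and diam_attained: "\<exists>a\<in>N. \<exists>b\<in>N. d a b = diam T"
proof -
  let ?S = "{d a b | a b. a \<in> N \<and> b \<in> N}"
  have "?S = (\<lambda>(a, b). d a b) ` (N \<times> N)" by auto
  then have fin: "finite ?S" using finite_N by simp
  show "a \<in> N \<Longrightarrow> b \<in> N \<Longrightarrow> d a b \<le> diam T"
    unfolding diam_def using fin by (intro Max_ge) auto
  have "?S \<noteq> {}" using N_nonempty by auto
  from Max_in[OF fin this] show "\<exists>a\<in>N. \<exists>b\<in>N. d a b = diam T"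
    unfolding diam_def by (smt (verit) mem_Collect_eq)
qed

text \<open>For any \<open>x\<close>, the midpoint \<open>c\<close> lies on the path from
  \<open>x\<close> to \<open>a\<close> or to \<open>b\<close>; that path has length
  \<open>d x c + h\<close>, which is at most \<open>2 * h\<close>.\<close>

lemma center_exists:
  assumes "diam T = 2 * h"
  obtains c a b where "c \<in> N" "a \<in> N" "b \<in> N" "d a c = h" "d b c = h" "c \<in> set (P a b)"
    "\<forall>x\<in>N. d x c \<le> h"
proof -
  obtain a b where ab: "a \<in> N" "b \<in> N" "d a b = 2 * h" using diam_attained assms by auto
  define c where "c = P a b ! h"
  have c: "c \<in> set (P a b)" "d a c = h" "d c b = h"
    using nth_P[OF ab(1,2), of h] ab(3) by (auto simp: c_def)
  have cN: "c \<in> N" using c(1) set_P ab by blast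
  have "d x c \<le> h" if x: "x \<in> N" for x
  proof -
    have "c \<in> set (P a x) \<or> c \<in> set (P x b)"
      using c(1) P_subset[OF ab(1) x ab(2)] by blast
    then have "d a x = d a c + d c x \<or> d x b = d x c + d c b"
      using between ab x cN by auto
    moreover have "d a x \<le> 2 * h" "d x b \<le> 2 * h" using d_le_diam ab x assms by auto
    ultimately show ?thesis using c d_sym[OF x cN] by auto
  qed
  then show ?thesis using that[of c a b] ab c cN d_sym[OF cN ab(2)] by simp
qed

text \<open>Two legs of length at most \<open>h\<close> add up to \<open>2 * h\<close> only if both
  equal \<open>h\<close>. In particular, a node with this radius bound is unique.\<close>

lemma middle_of_diameter:
  assumes "diam T = 2 * h" "c \<in> N" "\<forall>x\<in>N. d x c \<le> h"
    and "is_path T a p b" "length p = Suc (diam T)"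
  shows "p ! h = c"
proof -
  have ab: "a \<in> N" "b \<in> N" using path_nodes assms(4) by blast+
  have "d a b = 2 * h" using path_length[OF assms(4)] assms(1,5) by simp
  moreover have "d a b \<le> d a c + d c b" using triangle ab assms(2) by blast
  moreover have "d a c \<le> h" "d c b \<le> h" using assms(3) ab d_sym[OF assms(2) ab(2)] by auto
  ultimately have "c \<in> set (P a b)" "d a c = h" using between[OF ab(1) assms(2) ab(2)] by auto
  then show ?thesis using P_nth_d ab path_between_eqI[OF assms(4)] by metis
qed

text \<open>Two diametral endpoints lie in different branches at the center, so the branch of
  \<open>g\<close> misses at least one of them.\<close>

lemma far_node:
  assumes "c \<in> N" "a \<in> N" "b \<in> N" "d a c = h" "d b c = h" "c \<in> set (P a b)" "g \<in> N"
  obtains w where "w \<in> N" "d w c = h" "d w g = h + d c g"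
proof -
  have "c \<in> set (P a g) \<or> c \<in> set (P g b)" using P_subset[OF assms(2,7,3)] assms(6) by blast
  then show ?thesis
  proof
    assume "c \<in> set (P a g)"
    then show ?thesis using that[of a] between assms by metis
  next
    assume "c \<in> set (P g b)"
    then have "d g b = d g c + d c b" using between assms by blast
    then show ?thesis using that[of b] d_sym assms by (metis add.commute)
  qed
qed

section \<open>The distance from a node to the center\<close>

text \<open>\<open>ends v r\<close> are the far endpoints of the endless paths of \<open>V(v,r)\<close>.\<close>

definition ends :: "'v \<Rightarrow> nat \<Rightarrow> 'v set" where
  "ends v r = {x \<in> N. d v x = r \<and> degree T x \<noteq> 1}"

text \<open>Cutting the path to a node beyond the view after \<open>r\<close> edges leaves an
  endless path, because the cut is at an inner node.\<close>

lemma ends_inner: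
  assumes "v \<in> N" "x \<in> N" "0 < r" "r < d v x"
  shows "P v x ! r \<in> ends v r" "P v x ! r \<in> set (P v x)"
proof -
  have "r \<le> d v x" using assms by simp
  note n = nth_P[OF assms(1,2) this]
  show "P v x ! r \<in> set (P v x)" using n by simp
  then show "P v x ! r \<in> ends v r"
    using n degree_inner[OF assms] set_P[OF assms(1,2)] by (auto simp: ends_def)
qed

lemma ball_eq_nodes:
  assumes "v \<in> N" "0 < r" "ends v r = {}"
  shows "{x \<in> N. d v x \<le> r} = N"
proof -
  have "d v x \<le> r" if "x \<in> N" for x
    using ends_inner(1)[OF assms(1) that assms(2)] assms(3) by (metis empty_iff not_le)
  then show ?thesis by auto
qed

text \<open>An endless path of length \<open>2h - 2\<close> extends to one of length \<open>2h - 1\<close>, too long to stay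
  within one branch at the center.\<close>

lemma center_on_endless:
  assumes "2 \<le> h" "c \<in> N" "\<forall>x\<in>N. d x c \<le> h" "v \<in> N" "x \<in> ends v (2 * h - 2)"
  shows "c \<in> set (P v x)" "h \<le> d v c + 1"
proof -
  have x: "x \<in> N" "d v x = 2 * h - 2" "degree T x \<noteq> 1" using assms(5) by (auto simp: ends_def)
  then obtain y where y: "y \<in> N" "d v y = 2 * h - 1" "x \<in> set (P v y)"
    using extend_path[OF assms(4) x(1)] assms(1) by (auto simp: Suc_diff_Suc numeral_2_eq_2)
  have le: "d v c \<le> h" "d c y \<le> h" using assms(2,3,4) y(1) d_sym[of c y] by auto
  \<comment> \<open>Otherwise \<open>(2 * h - 1) + 2\<close> would be at most
    \<open>d v c + d c y\<close>, hence at most \<open>2 * h\<close>.\<close>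
  have cy: "c \<in> set (P v y)"
    using d_not_between[OF assms(4) y(1) assms(2)] le y(2) assms(1) by linarith
  \<comment> \<open>From \<open>2 \<le> h\<close> follows \<open>h \<le> 2 * h - 2\<close>, so
    \<open>c\<close> does not come after \<open>x\<close>.\<close>
  then show "c \<in> set (P v x)"
    using between_trans[OF assms(4) y(1) cy y(3)] le x(2) assms(1) by linarith
  show "h \<le> d v c + 1"
    using between[OF assms(4,2) y(1)] cy le y(2) by linarith
qed

text \<open>As \<open>c\<close> lies on every endless path, \<open>g\<close> lies at or beyond \<open>c\<close>. If \<open>d v c = h\<close>, no node is
  farther from \<open>g\<close> than \<open>v\<close>. If \<open>d v c = h - 1\<close> and \<open>g \<noteq> c\<close>, a node \<open>w\<close> of depth \<open>h\<close> outside the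
  branch of \<open>g\<close> is farther, and \<open>v\<close> sees \<open>w\<close>: otherwise the path from \<open>v\<close> to \<open>w\<close> would start
  with an endless path that misses \<open>g\<close>.\<close>

lemma distance_to_center:
  assumes h: "2 \<le> h" "diam T = 2 * h" and v: "v \<in> N"
    and ne: "ends v (2 * h - 2) \<noteq> {}"
    and c: "c \<in> N" "\<forall>x\<in>N. d x c \<le> h"
    and g: "g \<in> N" "\<forall>x\<in>ends v (2 * h - 2). g \<in> set (P v x)"
    and far: "\<forall>w\<in>N. (\<forall>x\<in>ends v (2 * h - 2). w \<in> set (P v x)) \<longrightarrow> d v w \<le> d v g"
  shows "c \<in> set (P v g)"
    and "d v c = (if d v g + 1 \<le> h \<or> (\<exists>w\<in>{x \<in> N. d v x \<le> 2 * h - 2}. d w g > d v g)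
                  then h - 1 else h)"
proof -
  obtain x where x: "x \<in> ends v (2 * h - 2)" using ne by blast
  then have xN: "x \<in> N" "d v x = 2 * h - 2" by (auto simp: ends_def)
  note ce = center_on_endless[OF h(1) c v]
  have cg: "d v c \<le> d v g" using far ce c by blast
  show cP: "c \<in> set (P v g)" using between_trans[OF v xN(1) ce(1)[OF x] g(2)[rule_format, OF x] cg] .
  then have dvg: "d v g = d v c + d c g" using between v c g by blast
  show "d v c = (if d v g + 1 \<le> h \<or> (\<exists>w\<in>{x \<in> N. d v x \<le> 2 * h - 2}. d w g > d v g)
                  then h - 1 else h)"
  proof (cases "d v c = h")
    case True
    have "d w g \<le> d v g" if "w \<in> N" for w
      using triangle[OF that c(1) g(1)] bspec[OF c(2) that] dvg True by simp
    then show ?thesis using True cg by (force simp: not_less)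
  next
    case False
    then have k: "d v c = h - 1" using ce(2)[OF x] c(2) v by fastforce
    have "\<exists>w\<in>{x \<in> N. d v x \<le> 2 * h - 2}. d w g > d v g" if "\<not> d v g + 1 \<le> h"
    proof -
      have j: "0 < d c g" using that dvg k h(1) by simp
      \<comment> \<open>Only the radius bound is known of \<open>c\<close>. Diametral endpoints come
        with a center \<open>c'\<close>, which equals \<open>c\<close> as the midpoint of the same
        path.\<close>
      obtain c' a b where c': "c' \<in> N" "a \<in> N" "b \<in> N" "d a c' = h" "d b c' = h"
        "c' \<in> set (P a b)" "\<forall>x\<in>N. d x c' \<le> h"
        using center_exists[OF h(2)] by metis
      have "d a b = 2 * h" using between[OF c'(2,1,3)] c' d_sym by simp
      then have "length (P a b) = Suc (diam T)" using length_P c' h by simp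
      then have "c = c'"
        using middle_of_diameter[OF h(2) c is_path_P] middle_of_diameter[OF h(2) c'(1,7) is_path_P]
          c' by metis
      then obtain w where w: "w \<in> N" "d w c = h" "d w g = h + d c g"
        using far_node[of c a b h g] c' g by metis
      have "d v w \<le> 2 * h - 2"
      proof (rule ccontr)
        assume *: "\<not> d v w \<le> 2 * h - 2"
        let ?y = "P v w ! (2 * h - 2)"
        have y: "?y \<in> ends v (2 * h - 2)" "?y \<in> set (P v w)"
          using ends_inner[OF v w(1), of "2 * h - 2"] * h(1) by auto
        have "g \<in> set (P v w)"
          using g(2) y(1) P_prefix_subset[OF v w(1) y(2)] by blast
        \<comment> \<open>This route is longer by \<open>2 * d c g\<close> than the one through
          \<open>c\<close>.\<close>
        then have "d v w = d v g + d g w" using between v w g by blast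
        moreover have "d v w \<le> d v c + d c w" using triangle v w c by blast
        ultimately show False using dvg j w d_sym[OF w(1) c(1)] d_sym[OF w(1) g(1)] by simp
      qed
      moreover have "d w g > d v g" using w dvg k h(1) by simp
      ultimately show ?thesis using w(1) by blast
    qed
    then show ?thesis using k by auto
  qed
qed

section \<open>Port sequences as names of nodes\<close>

lemma ports_along_inj:
  "walk T p \<Longrightarrow> walk T q \<Longrightarrow> hd p = hd q \<Longrightarrow> ports_along T p = ports_along T q \<Longrightarrow> p = q"
proof (induction p arbitrary: q rule: induct_list012)
  case 1
  then show ?case by (simp add: walk_def)
next
  case (2 x)
  then show ?case by (cases q rule: remdups_adj.cases) (auto simp: walk_def)
next
  case (3 x y zs)
  then obtain z ws where q: "q = x # z # ws"
    by (cases q rule: remdups_adj.cases) (auto simp: walk_def)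
  have "y = z"
    using 3 port_inj[of x y z] by (auto simp: q walk_successively)
  then show ?case
    using "3.IH"(2)[of "z # ws"] "3.prems" by (auto simp: q walk_successively)
qed

text \<open>Ports at a node are distinct, so a port sequence retraces its path; this makes the
  renaming in \<open>view\<close> faithful.\<close>

lemma seq_inj: "v \<in> N \<Longrightarrow> inj_on (seq T v) N"
proof (rule inj_onI)
  fix x y assume "v \<in> N" "x \<in> N" "y \<in> N" "seq T v x = seq T v y"
  then have "P v x = P v y"
    using is_path_P[of v x] is_path_P[of v y]
    by (intro ports_along_inj) (auto simp: is_path_def seq_def)
  then show "x = y"
    using is_path_P \<open>v \<in> N\<close> \<open>x \<in> N\<close> \<open>y \<in> N\<close> unfolding is_path_def by metis
qed

end

section \<open>Views\<close>

locale ptree_view = ptree T for T :: "('v, 'z) pgraph_scheme" +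
  fixes v :: 'v and r :: nat
  assumes v: "v \<in> nodes T"
begin

definition "B = {w \<in> N. d v w \<le> r}"
abbreviation "f \<equiv> seq T v"
abbreviation "V \<equiv> view T v r"

lemma B_subset: "B \<subseteq> N" and v_B: "v \<in> B"
  using v d_self by (auto simp: B_def)

lemma f_inj: "inj_on f B"
  using seq_inj[OF v] B_subset inj_on_subset by blast

lemma nodes_V: "nodes V = f ` B"
  and adj_V: "x \<in> B \<Longrightarrow> y \<in> B \<Longrightarrow> adj V (f x) (f y) \<longleftrightarrow> adj T x y"
  and port_V: "x \<in> B \<Longrightarrow> y \<in> B \<Longrightarrow> adj T x y \<Longrightarrow> port V (f x) (f y) = port T x y"
  and vdeg_V: "x \<in> B \<Longrightarrow> vdeg V (f x) = degree T x"
  and origin_V: "origin V = f v"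
  using f_inj by (auto simp: view_def Let_def B_def[symmetric] inv_into_f_f)

text \<open>Balls are convex: the path from \<open>x\<close> to \<open>y\<close> is covered by those
  from \<open>v\<close> to \<open>x\<close> and \<open>y\<close>, along which distances from
  \<open>v\<close> stay within \<open>r\<close>.\<close>

lemma P_B: "x \<in> B \<Longrightarrow> y \<in> B \<Longrightarrow> set (P x y) \<subseteq> B"
proof
  fix z assume xy: "x \<in> B" "y \<in> B" and z: "z \<in> set (P x y)"
  then have n: "x \<in> N" "y \<in> N" "z \<in> N" using B_subset set_P by blast+
  have "z \<in> set (P v x) \<or> z \<in> set (P v y)"
    using P_subset[OF n(1) v n(2)] z P_rev[OF v n(1)] by auto
  then have "d v z \<le> d v x \<or> d v z \<le> d v y" using between v n by fastforce
  then show "z \<in> B" using xy n by (auto simp: B_def)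
qed

lemma walk_V: "set p \<subseteq> B \<Longrightarrow> walk V (map f p) \<longleftrightarrow> walk T p"
proof -
  assume p: "set p \<subseteq> B"
  have "successively (adj V) (map f p) = successively (adj T) p"
    unfolding successively_map using p by (intro successively_cong) (auto simp: adj_V subset_iff)
  then show ?thesis using p B_subset by (auto simp: walk_successively nodes_V)
qed

text \<open>Gives existence and uniqueness of paths in the view at once, so its \<open>THE\<close>
  and \<open>LEAST\<close> can be evaluated. The view need not be a \<open>port_tree\<close>: a port
  at its boundary may exceed the degree within the view.\<close>

lemma is_path_V:
  assumes "x \<in> B" "y \<in> B"
  shows "is_path V (f x) q (f y) \<longleftrightarrow> q = map f (P x y)"
proof
  assume q: "is_path V (f x) q (f y)"
  then have "q \<in> lists (f ` B)" by (auto simp: is_path_def walk_def nodes_V)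
  then obtain p where p: "q = map f p" "set p \<subseteq> B"
    by (auto simp: lists_image)
  have ne: "p \<noteq> []" using q p by (auto simp: is_path_def walk_def)
  then have "hd p \<in> B" "last p \<in> B" using p(2) by auto
  moreover have "f (hd p) = f x" "f (last p) = f y"
    using q ne by (auto simp: is_path_def p hd_map last_map)
  ultimately have "hd p = x" "last p = y" using f_inj assms by (auto simp: inj_on_eq_iff)
  then have "is_path T x p y"
    using q walk_V[OF p(2)] by (auto simp: is_path_def p distinct_map)
  then show "q = map f (P x y)" using path_between_eqI p by simp
next
  assume q: "q = map f (P x y)"
  have n: "x \<in> N" "y \<in> N" using assms B_subset by auto
  note p = is_path_P[OF n] and sub = P_B[OF assms]
  have "inj_on f (set (P x y))" using f_inj sub inj_on_subset by blast
  then show "is_path V (f x) q (f y)"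
    using p walk_V[OF sub] unfolding is_path_def q
    by (auto simp: distinct_map hd_map last_map walk_def)
qed

lemma path_between_V: "x \<in> B \<Longrightarrow> y \<in> B \<Longrightarrow> path_between V (f x) (f y) = map f (P x y)"
  unfolding path_between_def by (simp add: is_path_V path_between_def[symmetric])

lemma tdist_V: "x \<in> B \<Longrightarrow> y \<in> B \<Longrightarrow> tdist V (f x) (f y) = d x y"
proof -
  assume xy: "x \<in> B" "y \<in> B"
  then have "length (P x y) = Suc (d x y)" using length_P B_subset by blast
  then show ?thesis
    unfolding tdist_def[of V] by (intro Least_equality) (auto simp: is_path_V xy)
qed

lemma ports_along_V: "walk T p \<Longrightarrow> set p \<subseteq> B \<Longrightarrow> ports_along V (map f p) = ports_along T p"
  by (induction p rule: induct_list012) (auto simp: walk_successively port_V adj_sym)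

lemma seq_V: "x \<in> B \<Longrightarrow> y \<in> B \<Longrightarrow> seq V (f x) (f y) = seq T x y"
  using is_path_P[of x y] B_subset P_B[of x y]
  unfolding seq_def[of V] seq_def[of T x]
  by (simp add: path_between_V ports_along_V is_path_def subset_iff)

section \<open>Endless paths and \<open>g_node\<close> in the view\<close>

lemma endless_V: "endless_path V r q \<longleftrightarrow> (\<exists>x\<in>ends v r. q = map f (P v x))"
proof
  assume q: "endless_path V r q"
  then have "walk V q" by (simp add: endless_path_def is_path_def)
  then have "last q \<in> f ` B" using last_in_set[of q] by (auto simp: walk_def nodes_V)
  then obtain x where x: "x \<in> B" "last q = f x" by blast
  then have p: "q = map f (P v x)"
    using q is_path_V[OF v_B x(1)] by (simp add: endless_path_def origin_V)
  have xN: "x \<in> N" using x B_subset by blast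
  \<comment> \<open>\<open>vdeg\<close> records the degree in \<open>T\<close>, so the leaf test is
    about the tree and not about the view.\<close>
  have "x \<in> ends v r"
    using q x xN length_P[OF v xN] by (auto simp: endless_path_def ends_def p vdeg_V)
  then show "\<exists>x\<in>ends v r. q = map f (P v x)" using p by blast
next
  assume "\<exists>x\<in>ends v r. q = map f (P v x)"
  then obtain x where x: "x \<in> ends v r" "q = map f (P v x)" by blast
  then have xN: "x \<in> N" "d v x = r" "degree T x \<noteq> 1" and xB: "x \<in> B"
    by (auto simp: ends_def B_def)
  have path: "is_path V (f v) q (f x)" using is_path_V[OF v_B xB] x by simp
  then have "last q = f x" by (simp add: is_path_def)
  then show "endless_path V r q"
    using path xN length_P[OF v xN(1)] xB
    by (auto simp: endless_path_def origin_V vdeg_V x(2))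
qed

lemma ends_B: "ends v r \<subseteq> B"
  by (auto simp: ends_def B_def)

lemma on_endless_V:
  "w \<in> B \<Longrightarrow> (\<forall>p. endless_path V r p \<longrightarrow> f w \<in> set p) \<longleftrightarrow> (\<forall>x\<in>ends v r. w \<in> set (P v x))"
proof -
  assume w: "w \<in> B"
  have "f w \<in> f ` set (P v x) \<longleftrightarrow> w \<in> set (P v x)" if "x \<in> ends v r" for x
    using that ends_B P_B[OF v_B] f_inj w by (intro inj_on_image_mem_iff) auto
  then show ?thesis by (auto simp: endless_V)
qed

lemma g_node_V:
  assumes "ends v r \<noteq> {}"
  obtains g where "g \<in> B" "g_node V r = f g" "\<forall>x\<in>ends v r. g \<in> set (P v x)"
    "\<forall>w\<in>N. (\<forall>x\<in>ends v r. w \<in> set (P v x)) \<longrightarrow> d v w \<le> d v g"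
proof -
  let ?Q = "\<lambda>w. w \<in> nodes V \<and> (\<forall>p. endless_path V r p \<longrightarrow> w \<in> set p)"
  have fin: "finite (Collect ?Q)"
    using finite_subset[OF B_subset finite_N] by (simp add: nodes_V)
  \<comment> \<open>The origin lies on every endless path and is thus a candidate for the
    maximum.\<close>
  have "v \<in> set (P v x)" if "x \<in> ends v r" for x
    using that set_P v by (auto simp: ends_def)
  then have "?Q (f v)" using v_B on_endless_V by (auto simp: nodes_V)
  then have ne: "Collect ?Q \<noteq> {}" by blast
  have m: "is_arg_max (tdist V (origin V)) ?Q (g_node V r)"
    unfolding g_node_def using arg_max_finite[OF fin ne] .
  then obtain g where g: "g \<in> B" "g_node V r = f g"
    by (auto simp: is_arg_max_linorder nodes_V)
  have "\<forall>x\<in>ends v r. g \<in> set (P v x)"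
    using m g on_endless_V by (auto simp: is_arg_max_linorder)
  moreover have "d v w \<le> d v g"
    if "w \<in> N" and w: "\<forall>x\<in>ends v r. w \<in> set (P v x)" for w
  proof -
    \<comment> \<open>Some endless path exists and stays in the ball, so \<open>w\<close> is
      visible.\<close>
    have wB: "w \<in> B" using w assms ends_B P_B[OF v_B] by blast
    then have "?Q (f w)" using w on_endless_V by (auto simp: nodes_V)
    then show ?thesis using m wB g v_B by (auto simp: is_arg_max_linorder origin_V tdist_V)
  qed
  ultimately show ?thesis using that g by blast
qed

section \<open>The center computed from the view\<close>

lemma central_node_V:
  assumes "B = N" "diam T = 2 * h" "c \<in> N" "\<forall>x\<in>N. d x c \<le> h"
  shows "central_node V = f c"
proof -
  have "{tdist V s t | s t. s \<in> nodes V \<and> t \<in> nodes V} = {d x y | x y. x \<in> N \<and> y \<in> N}"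
    (is "?L = ?R")
  proof -
    have "?L = {tdist V (f x) (f y) | x y. x \<in> N \<and> y \<in> N}"
      unfolding nodes_V assms(1) by blast
    also have "\<dots> = ?R" using tdist_V unfolding assms(1) by metis
    finally show ?thesis .
  qed
  then have diam: "diam V = 2 * h" using assms(2) by (simp add: diam_def)
  have mid: "q ! h = f c" if q: "is_path V s q t" "length q = Suc (2 * h)" for s t q
  proof -
    have "walk V q" "hd q = s" "last q = t" using q by (auto simp: is_path_def)
    then have "s \<in> nodes V" "t \<in> nodes V" by (auto simp: walk_def subset_iff)
    then obtain x y where xy: "s = f x" "t = f y" "x \<in> B" "y \<in> B" by (auto simp: nodes_V)
    then have p: "q = map f (P x y)" using q is_path_V by simp
    then have "P x y ! h = c"
      using middle_of_diameter[OF assms(2-4) is_path_P] xy assms(1,2) q(2) by simp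
    then show ?thesis using q(2) by (simp add: p)
  qed
  \<comment> \<open>A diametral path is needed for uniqueness; without one the condition in
    \<open>central_node\<close> would hold vacuously for all nodes.\<close>
  obtain a b where ab: "a \<in> N" "b \<in> N" "d a b = 2 * h" using diam_attained assms(2) by auto
  then have ex: "is_path V (f a) (map f (P a b)) (f b)" "length (map f (P a b)) = Suc (2 * h)"
    using is_path_V assms(1) length_P by auto
  show ?thesis
    unfolding central_node_def diam
  proof (rule the_equality)
    show "f c \<in> nodes V \<and>
        (\<forall>a b p. is_path V a p b \<and> length p = Suc (2 * h) \<longrightarrow> p ! (2 * h div 2) = f c)"
      using mid assms(1,3) by (auto simp: nodes_V)
    fix s assume "s \<in> nodes V \<and>
        (\<forall>a b p. is_path V a p b \<and> length p = Suc (2 * h) \<longrightarrow> p ! (2 * h div 2) = s)"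
    then have "map f (P a b) ! (2 * h div 2) = s" using ex by blast
    then show "s = f c" using mid[OF ex] by simp
  qed
qed

lemma center_V:
  assumes "2 \<le> h" "diam T = 2 * h" "r = 2 * h - 2" "c \<in> N" "\<forall>x\<in>N. d x c \<le> h"
  shows "c \<in> B" "even_elect_center (2 * h) V = f c"
proof -
  have r: "2 * h - 2 = r" "2 * h div 2 = h" using assms(3) by auto
  have "h \<le> r" using assms(1,3) by simp
  then show cB: "c \<in> B" using assms(4) bspec[OF assms(5) v] by (simp add: B_def)
  show "even_elect_center (2 * h) V = f c"
  proof (cases "ends v r = {}")
    case True
    moreover have "0 < r" using assms(1,3) by simp
    ultimately have "B = N" unfolding B_def by (intro ball_eq_nodes v)
    from central_node_V[OF this assms(2,4,5)] show ?thesis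
      unfolding even_elect_center_def Let_def r using True by (simp add: endless_V)
  next
    case False
    then have ex: "\<exists>p. endless_path V r p" by (auto simp: endless_V)
    obtain g where g: "g \<in> B" "g_node V r = f g" "\<forall>x\<in>ends v r. g \<in> set (P v x)"
      "\<forall>w\<in>N. (\<forall>x\<in>ends v r. w \<in> set (P v x)) \<longrightarrow> d v w \<le> d v g"
      using g_node_V[OF False] by metis
    have gN: "g \<in> N" using g B_subset by blast
    note dc = distance_to_center[OF assms(1,2) v False[unfolded assms(3)] assms(4,5) gN
      g(3,4)[unfolded assms(3)], folded assms(3), folded B_def]
    define l where "l = (if d v g + 1 \<le> h \<or> (\<exists>w\<in>B. d w g > d v g) then h - 1 else h)"
    have "even_elect_center (2 * h) V =
        (THE c. c \<in> set (path_between V (f v) (f g)) \<and> tdist V (f v) c = l)"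
      unfolding even_elect_center_def Let_def r origin_V g(2) l_def
      using ex by (simp add: nodes_V tdist_V[OF v_B g(1)] tdist_V[OF _ g(1)] cong: bex_cong)
    also have "\<dots> = f c"
    proof (rule the_equality)
      show "f c \<in> set (path_between V (f v) (f g)) \<and> tdist V (f v) (f c) = l"
        using dc g(1) v_B cB by (simp add: path_between_V tdist_V l_def)
      fix s assume s: "s \<in> set (path_between V (f v) (f g)) \<and> tdist V (f v) s = l"
      then obtain x where x: "x \<in> set (P v g)" "s = f x"
        using g(1) v_B by (auto simp: path_between_V)
      moreover have "x \<in> B" using x P_B[OF v_B g(1)] by blast
      ultimately have "d v x = d v c" using s dc(2) v_B by (simp add: tdist_V l_def)
      \<comment> \<open>A node of the path is determined by its distance from
        \<open>v\<close>.\<close>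
      then have "x = c" using P_nth_d[OF v gN] x(1) dc(1) by metis
      then show "s = f c" using x by simp
    qed
    finally show ?thesis .
  qed
qed

text \<open>The degree of the only node is 0, not 1, so its trivial path counts as endless and
  the algorithm enters the branch that computes \<open>g_node\<close>.\<close>

lemma center_V_singleton:
  assumes "diam T = 0" "r = 0"
  shows "even_elect_center 0 V = f v"
proof -
  have N: "x = v" if "x \<in> N" for x
    using d_le_diam[OF that v] d_eq_0[OF that v] assms by simp
  have "nbrs T v = {}" using N adj_nodes by (auto simp: nbrs_def)
  then have "v \<in> ends v 0" using v d_self by (simp add: ends_def degree_def)
  then have ne: "ends v r \<noteq> {}" using assms by auto
  then have ex: "\<exists>p. endless_path V r p" by (auto simp: endless_V)
  obtain g where g: "g \<in> B" "g_node V r = f g" using g_node_V[OF ne] by metis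
  have B: "B = {v}" using N v_B B_subset by auto
  have "P v v = [v]" using v by (intro path_between_eqI) (simp add: is_path_def walk_def)
  then have path: "path_between V (f v) (f v) = [f v]" "tdist V (f v) (f v) = 0"
    using path_between_V tdist_V v_B d_self v by auto
  have r: "0 - 2 = r" "g = v" using assms(2) g(1) B by auto
  show ?thesis
    \<comment> \<open>With \<open>h = 0\<close> both possible lengths \<open>h - 1\<close> and
      \<open>h\<close> are 0 by truncation, which selects the origin.\<close>
    unfolding even_elect_center_def Let_def r origin_V g(2)
    using ex path by auto
qed

end

section \<open>Correctness and size of advice\<close>

lemma odd_terms_ports_along:
  "p \<noteq> [] \<Longrightarrow> length (odd_terms (ports_along G p)) = length p - 1"
  "Suc i < length p \<Longrightarrow> odd_terms (ports_along G p) ! i = port G (p ! i) (p ! Suc i)"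
proof -
  show "p \<noteq> [] \<Longrightarrow> length (odd_terms (ports_along G p)) = length p - 1"
    by (induction p rule: induct_list012) auto
  show "Suc i < length p \<Longrightarrow> odd_terms (ports_along G p) ! i = port G (p ! i) (p ! Suc i)"
    by (induction p arbitrary: i rule: induct_list012) (auto simp: nth_Cons split: nat.split)
qed

lemma follows_path: "is_path G a p b \<Longrightarrow> follows G a (odd_terms (ports_along G p)) p"
  by (auto simp: follows_def is_path_def walk_def odd_terms_ports_along)

lemma length_encode_nat: "length (encode_nat n) = floorlog 2 n"
  by (simp add: encode_nat_def bitlen_def)

lemma decode_encode_nat: "decode_nat (encode_nat n) = n"
proof -
  \<comment> \<open>Zero is encoded by the empty string and treated apart.\<close>
  have "n < 2 ^ floorlog 2 n" using floorlog_bounds[of n 2] by (cases "n = 0") auto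
  then show ?thesis
    by (simp add: decode_nat_def encode_nat_def horner_sum_bit_eq_take_bit bitlen_def
        take_bit_nat_eq_self)
qed

text \<open>\<open>c\<close> is fixed before \<open>v\<close>, so the paths output by all nodes
  share the end \<open>c\<close>.\<close>

lemma EvenElect_correct:
  assumes "port_tree T" "even (diam T)" "diam T \<noteq> 2"
  shows "solves_leader_election EvenElect T (even_elect_advice T) (diam T - 2)"
proof -
  interpret ptree T using assms by unfold_locales
  obtain h where h: "diam T = 2 * h" using assms(2) by blast
  obtain c where c: "c \<in> N" "\<forall>x\<in>N. d x c \<le> h" using center_exists[OF h] by metis
  have "decide EvenElect (even_elect_advice T) (view T v (diam T - 2)) =
      odd_terms (ports_along T (P v c))" if v: "v \<in> N" for v
  proof -
    interpret ptree_view T v "diam T - 2" using v by unfold_locales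
    have "c \<in> B \<and> even_elect_center (diam T) V = f c"
    proof (cases "h = 0")
      case True
      then have "c = v" using d_eq_0[OF v c(1)] c(2) v by auto
      then show ?thesis using center_V_singleton v_B h True by simp
    next
      case False
      \<comment> \<open>Diameter 2 is excluded, which rules out \<open>h = 1\<close>.\<close>
      then have "2 \<le> h" using h assms(3) by (cases "h = 1") auto
      then show ?thesis using center_V[of h c] h c by simp
    qed
    then show ?thesis
      using v_B
      by (simp add: EvenElect_def even_elect_advice_def decode_encode_nat origin_V seq_V)
        (simp add: seq_def)
  qed
  then have "elects_leader T (\<lambda>v. decide EvenElect (even_elect_advice T) (view T v (diam T - 2)))"
    unfolding elects_leader_def using c(1) follows_path is_path_P by metis
  moreover have "rounds EvenElect (even_elect_advice T) = diam T - 2"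
    by (simp add: EvenElect_def even_elect_advice_def decode_encode_nat)
  ultimately show ?thesis by (simp add: solves_leader_election_def)
qed

lemma floorlog_bigo: "(\<lambda>n. real (floorlog 2 n)) \<in> O(\<lambda>n. log 2 (real n))"
\<comment> \<open>From \<open>n = 2\<close> on the logarithm is at least 1 and absorbs the summand 1
  of \<open>floorlog\<close>.\<close>
proof (rule bigoI[where c = 2])
  show "\<forall>\<^sub>F n in sequentially. norm (real (floorlog 2 n)) \<le> 2 * norm (log 2 (real n))"
    using eventually_ge_at_top[of 2]
  proof eventually_elim
    case (elim n)
    then have "1 \<le> log 2 (real n)" by (simp add: le_log_iff)
    moreover have "real (floorlog 2 n) \<le> log 2 (real n) + 1"
      using elim \<open>1 \<le> log 2 (real n)\<close> by (simp add: floorlog_def)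
    ultimately show ?case by simp
  qed
qed

theorem theorem4p1:
  shows "\<exists>b :: nat \<Rightarrow> real. b \<in> O(\<lambda>D. log 2 (real D)) \<and>
    (\<forall>(T :: 'v pgraph) n D.
       port_tree T \<and> card (nodes T) = n \<and> even (diam T) \<and> diam T \<noteq> 2 \<and> diam T \<le> D \<longrightarrow>
         solves_leader_election EvenElect T (even_elect_advice T) (diam T - 2) \<and>
         real (length (even_elect_advice T)) \<le> b D)"
proof (intro exI conjI allI impI)
  \<comment> \<open>The advice has length \<open>floorlog 2 (diam T)\<close>; monotonicity gives a
    bound depending on \<open>D\<close> alone.\<close>
  show "(\<lambda>D. real (floorlog 2 D)) \<in> O(\<lambda>D. log 2 (real D))" by (rule floorlog_bigo)
  fix T :: "'v pgraph" and n D
  assume *: "port_tree T \<and> card (nodes T) = n \<and> even (diam T) \<and> diam T \<noteq> 2 \<and> diam T \<le> D"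
  then show "solves_leader_election EvenElect T (even_elect_advice T) (diam T - 2)"
    using EvenElect_correct by blast
  show "real (length (even_elect_advice T)) \<le> real (floorlog 2 D)"
    using * floorlog_mono by (simp add: even_elect_advice_def length_encode_nat)
qed

end
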